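(* The following metrizable spaces have enough arcs: (1) Every nondegenerate metrizable space $X$ admitting a minimal continuous flow, i.e. a minimal continuous action of $\mathbb{R}$ on $X$. (2) Every nondegenerate metrizable continuum $X$ all of whose composants are arcwise connected. In particular, solenoids and Knaster continua have enough arcs.
   Context: A space is nondegenerate if it has at least two points. An arc is a homeomorphic copy of $[0,1]$. A space with enough arcs is a nondegenerate metrizable space $X$ such that for every nonempty proper closed subset $A\subseteq X$ there is an arc in $X$ with one endpoint in $A$ and the other endpoint in $X\setminus A$. A continuous flow on $X$ is minimal if every orbit is dense in $X$. A continuum is a nonempty compact connected space. The composant of a point $p$ in a continuum $X$ is the union of all proper subcontinua of $X$ containing $p$. Arcwise connected means any two distinct points are the endpoints of an arc in the space. Solenoids (respectively Knaster continua) are the inverse limits of sequences of circles (respectively arcs) with open continuous bonding maps that are not homeomorphisms. *)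

theory Defs
  imports "HOL-Analysis.Analysis"
begin

definition nondegenerate_space :: "'a topology \<Rightarrow> bool" where
  "nondegenerate_space X \<longleftrightarrow> (\<exists>x\<in>topspace X. \<exists>y\<in>topspace X. x \<noteq> y)"

definition arc_space :: "'a topology \<Rightarrow> bool" where
  "arc_space X \<longleftrightarrow> X homeomorphic_space (top_of_set {0..1::real})"

definition circle_space :: "'a topology \<Rightarrow> bool" where
  "circle_space X \<longleftrightarrow> X homeomorphic_space (top_of_set (sphere (0::complex) 1))"

definition arc_in_with_endpoints :: "'a topology \<Rightarrow> 'a set \<Rightarrow> 'a \<Rightarrow> 'a \<Rightarrow> bool" where
  "arc_in_with_endpoints X C a b \<longleftrightarrow> C \<subseteq> topspace X \<and>
     (\<exists>h. homeomorphic_map (top_of_set {0..1::real}) (subtopology X C) h \<and> h 0 = a \<and> h 1 = b)"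

definition enough_arcs :: "'a topology \<Rightarrow> bool" where
  "enough_arcs X \<longleftrightarrow> nondegenerate_space X \<and> metrizable_space X \<and>
     (\<forall>A. closedin X A \<and> A \<noteq> {} \<and> A \<noteq> topspace X \<longrightarrow>
        (\<exists>C a b. arc_in_with_endpoints X C a b \<and> a \<in> A \<and> b \<in> topspace X - A))"

definition arcwise_connected_space :: "'a topology \<Rightarrow> bool" where
  "arcwise_connected_space X \<longleftrightarrow>
     (\<forall>x\<in>topspace X. \<forall>y\<in>topspace X. x \<noteq> y \<longrightarrow> (\<exists>C. arc_in_with_endpoints X C x y))"

text \<open>The values of a flow outside \<open>topspace X\<close> are irrelevant.\<close>

definition continuous_flow :: "'a topology \<Rightarrow> (real \<Rightarrow> 'a \<Rightarrow> 'a) \<Rightarrow> bool" where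
  "continuous_flow X \<phi> \<longleftrightarrow>
     continuous_map (prod_topology euclideanreal X) X (\<lambda>(t, x). \<phi> t x) \<and>
     (\<forall>x\<in>topspace X. \<phi> 0 x = x) \<and>
     (\<forall>x\<in>topspace X. \<forall>s t. \<phi> (s + t) x = \<phi> s (\<phi> t x))"

definition minimal_flow :: "'a topology \<Rightarrow> (real \<Rightarrow> 'a \<Rightarrow> 'a) \<Rightarrow> bool" where
  "minimal_flow X \<phi> \<longleftrightarrow> continuous_flow X \<phi> \<and>
     (\<forall>x\<in>topspace X. X closure_of (range (\<lambda>t. \<phi> t x)) = topspace X)"

definition continuum :: "'a topology \<Rightarrow> bool" where
  "continuum X \<longleftrightarrow> topspace X \<noteq> {} \<and> compact_space X \<and> connected_space X"

definition subcontinuum :: "'a topology \<Rightarrow> 'a set \<Rightarrow> bool" where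
  "subcontinuum X K \<longleftrightarrow> K \<subseteq> topspace X \<and> continuum (subtopology X K)"

definition composant :: "'a topology \<Rightarrow> 'a \<Rightarrow> 'a set" where
  "composant X p = \<Union>{K. subcontinuum X K \<and> K \<noteq> topspace X \<and> p \<in> K}"

definition inverse_limit :: "(nat \<Rightarrow> 'a topology) \<Rightarrow> (nat \<Rightarrow> 'a \<Rightarrow> 'a) \<Rightarrow> (nat \<Rightarrow> 'a) topology" where
  "inverse_limit X f = subtopology (product_topology X UNIV) {x. \<forall>n. x n = f n (x (Suc n))}"

definition open_nonhomeomorphic_bonding ::
    "(nat \<Rightarrow> 'a topology) \<Rightarrow> (nat \<Rightarrow> 'a \<Rightarrow> 'a) \<Rightarrow> bool" where
  "open_nonhomeomorphic_bonding X f \<longleftrightarrow>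
     (\<forall>n. continuous_map (X (Suc n)) (X n) (f n) \<and> open_map (X (Suc n)) (X n) (f n) \<and>
          \<not> homeomorphic_map (X (Suc n)) (X n) (f n))"

text \<open>
  The inverse sequence is an argument of the next two predicates, rather than existentially
  quantified, so that the circles (arcs) may live in any type; a solenoid (Knaster continuum) is
  understood up to homeomorphism.
\<close>

definition solenoid_of :: "(nat \<Rightarrow> 'b topology) \<Rightarrow> (nat \<Rightarrow> 'b \<Rightarrow> 'b) \<Rightarrow> 'a topology \<Rightarrow> bool" where
  "solenoid_of X f S \<longleftrightarrow> (\<forall>n. circle_space (X n)) \<and> open_nonhomeomorphic_bonding X f \<and>
     S homeomorphic_space (inverse_limit X f)"

definition knaster_continuum_of ::
    "(nat \<Rightarrow> 'b topology) \<Rightarrow> (nat \<Rightarrow> 'b \<Rightarrow> 'b) \<Rightarrow> 'a topology \<Rightarrow> bool" where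
  "knaster_continuum_of X f S \<longleftrightarrow> (\<forall>n. arc_space (X n)) \<and> open_nonhomeomorphic_bonding X f \<and>
     S homeomorphic_space (inverse_limit X f)"

end

theory Submission
  imports Defs "HOL-Complex_Analysis.Conformal_Mappings"
begin

text \<open>For a closed set \<open>A\<close>, the arc that leaves \<open>A\<close> is found in a different way in each case.

Under a minimal flow the orbit of a point of \<open>A\<close> leaves \<open>A\<close>. Its return times to its initial point
form a closed subgroup of the reals, and a subgroup with arbitrarily small positive elements would make
the point fixed, hence not dense. So the orbit is locally injective
(\<open>nonfixed_orbit_locally_injective\<close>), and a sufficiently short piece of it near a time at which it
leaves \<open>A\<close> is the arc.

In a continuum every composant is dense, by boundary bumping (\<open>composant_escapes_closed\<close>). So the
composant of a point of \<open>A\<close> has a point outside \<open>A\<close>, and an arc inside the composant joins the two.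

In an inverse limit of circles or of arcs with open bonding maps, a point \<open>a\<close> of \<open>A\<close> and a point \<open>c\<close>
outside \<open>A\<close> are told apart by some stage \<open>N\<close>, in the sense that every thread with \<open>N\<close>-th coordinate
\<open>c N\<close> is outside \<open>A\<close>. An arc from \<open>a N\<close> to \<open>c N\<close> in that stage is lifted through the later bonding maps,
starting at the coordinates of \<open>a\<close> (\<open>arc_lift\<close>). The lifts fit together into a path in the inverse limit
that starts at \<open>a\<close> and ends outside \<open>A\<close>; it is injective because its \<open>N\<close>-th coordinate is.

Circles and arcs are treated together: both are images of the line under an open map that wraps
infinitely often in both directions, \<open>exp (\<i> t)\<close> for the circle and \<open>cos t\<close> for the interval \<open>[-1, 1]\<close>.
Composing with an open bonding map gives a map of the same kind, so that the only lifting problem to be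
solved is that of an arc through an open map defined on the real line.\<close>

section \<open>Arcs\<close>

lemma arc_in_with_endpoints_injective_path:
  assumes "Hausdorff_space X" and \<gamma>: "continuous_map (top_of_set {0..1::real}) X \<gamma>" "inj_on \<gamma> {0..1}"
  shows "arc_in_with_endpoints X (\<gamma> ` {0..1}) (\<gamma> 0) (\<gamma> 1)"
proof -
  have sub: "\<gamma> ` {0..1} \<subseteq> topspace X"
    using continuous_map_image_subset_topspace[OF \<gamma>(1)] by simp
  have "homeomorphic_map (top_of_set {0..1}) (subtopology X (\<gamma> ` {0..1})) \<gamma>"
    using assms sub
    by (intro continuous_imp_homeomorphic_map)
       (auto simp: continuous_map_in_subtopology compact_space_subtopology Hausdorff_space_subtopology)
  with sub show ?thesis
    unfolding arc_in_with_endpoints_def by blast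
qed

lemma arc_in_with_endpoints_imp_injective_path:
  assumes "arc_in_with_endpoints X C a b"
  obtains \<gamma> where "continuous_map (top_of_set {0..1::real}) X \<gamma>" "inj_on \<gamma> {0..1}"
    "\<gamma> ` {0..1} = C" "\<gamma> 0 = a" "\<gamma> 1 = b"
proof -
  obtain h where C: "C \<subseteq> topspace X" and h: "homeomorphic_map (top_of_set {0..1::real}) (subtopology X C) h"
    and e: "h 0 = a" "h 1 = b"
    using assms unfolding arc_in_with_endpoints_def by blast
  show ?thesis
  proof
    show "continuous_map (top_of_set {0..1}) X h"
      using homeomorphic_imp_continuous_map[OF h] by (simp add: continuous_map_in_subtopology)
    show "inj_on h {0..1}"
      using homeomorphic_imp_injective_map[OF h] by simp
    show "h ` {0..1} = C"
      using homeomorphic_imp_surjective_map[OF h] C by auto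
  qed (fact e)+
qed

lemma arc_in_with_endpoints_subtopology:
  assumes "arc_in_with_endpoints (subtopology X S) C a b"
  shows "arc_in_with_endpoints X C a b"
  using assms unfolding arc_in_with_endpoints_def
  by (auto simp: subtopology_subtopology inf_absorb2)

lemma arc_in_with_endpoints_homeomorphic_image:
  assumes "homeomorphic_map X Y k" "arc_in_with_endpoints X C a b"
  shows "arc_in_with_endpoints Y (k ` C) (k a) (k b)"
proof -
  obtain h where C: "C \<subseteq> topspace X" and h: "homeomorphic_map (top_of_set {0..1::real}) (subtopology X C) h"
    and e: "h 0 = a" "h 1 = b"
    using assms(2) unfolding arc_in_with_endpoints_def by blast
  have kX: "k ` topspace X = topspace Y"
    using assms(1) homeomorphic_imp_surjective_map by blast
  have "homeomorphic_map (subtopology X C) (subtopology Y (k ` C)) k"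
    by (rule homeomorphic_map_subtopologies[OF assms(1)]) (use C kX in auto)
  from homeomorphic_map_compose[OF h this] show ?thesis
    unfolding arc_in_with_endpoints_def using C e kX by (intro conjI exI[of _ "k \<circ> h"]) auto
qed

lemma enough_arcs_homeomorphic_space:
  assumes "X homeomorphic_space Y" "enough_arcs X"
  shows "enough_arcs Y"
proof -
  obtain k where k: "homeomorphic_map X Y k"
    using assms(1) homeomorphic_space by blast
  have kX: "k ` topspace X = topspace Y" and inj: "inj_on k (topspace X)"
    using k homeomorphic_imp_surjective_map homeomorphic_imp_injective_map by blast+
  show ?thesis
    unfolding enough_arcs_def
  proof (intro conjI allI impI)
    show "nondegenerate_space Y"
      using assms(2) inj unfolding enough_arcs_def nondegenerate_space_def kX[symmetric]
      by (auto simp: inj_on_def)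
    show "metrizable_space Y"
      using assms homeomorphic_metrizable_space unfolding enough_arcs_def by blast
  next
    fix A assume A: "closedin Y A \<and> A \<noteq> {} \<and> A \<noteq> topspace Y"
    define B where "B = {x \<in> topspace X. k x \<in> A}"
    have "closedin X B"
      using A homeomorphic_imp_continuous_map[OF k] unfolding B_def
      by (auto intro: closedin_continuous_map_preimage)
    moreover have kB: "k ` B = A"
      using A kX closedin_subset[of Y A] unfolding B_def by (auto simp: image_iff subset_iff) 
    moreover have "B \<noteq> {}" "B \<noteq> topspace X"
      using A kB kX by auto
    ultimately obtain C a b where C: "arc_in_with_endpoints X C a b" "a \<in> B" "b \<in> topspace X - B"
      using assms(2) unfolding enough_arcs_def by blast
    have "k a \<in> A" "k b \<in> topspace Y - A"
      using C kX unfolding B_def by auto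
    with arc_in_with_endpoints_homeomorphic_image[OF k C(1)]
    show "\<exists>C a b. arc_in_with_endpoints Y C a b \<and> a \<in> A \<and> b \<in> topspace Y - A" by blast
  qed
qed

section \<open>Minimal flows\<close>

lemma continuous_map_orbit:
  assumes "continuous_flow X \<phi>" "a \<in> topspace X"
  shows "continuous_map euclideanreal X (\<lambda>t. \<phi> t a)"
proof -
  have "continuous_map euclideanreal (prod_topology euclideanreal X) (\<lambda>t. (t, a))"
    using assms(2) by (auto simp: continuous_map_pairwise o_def)
  from continuous_map_compose[OF this] assms(1) show ?thesis
    unfolding continuous_flow_def by (fastforce simp: o_def)
qed

text \<open>The set of \<open>t\<close> with \<open>\<phi> t a = a\<close> is a closed subgroup of the reals that omits \<open>t\<^sub>0\<close>. A positive element
\<open>p\<close> of it has an integer multiple within \<open>p\<close> below \<open>t\<^sub>0\<close>, so \<open>p\<close> cannot be less than the distance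
from \<open>t\<^sub>0\<close> to the group. Two times with the same position differ by an element of the group.\<close>

lemma nonfixed_orbit_locally_injective:
  assumes flow: "continuous_flow X \<phi>" and "Hausdorff_space X" and a: "a \<in> topspace X"
    and "\<phi> t\<^sub>0 a \<noteq> a"
  obtains p where "p > 0" "\<And>s t. \<lbrakk>\<phi> s a = \<phi> t a; \<bar>s - t\<bar> < p\<rbrakk> \<Longrightarrow> s = t"
proof -
  define P where "P = {t. \<phi> t a = a}"
  have add: "\<phi> (s + t) a = \<phi> s (\<phi> t a)" and zero: "\<phi> 0 a = a" for s t
    using flow a unfolding continuous_flow_def by auto
  have diff: "s - t \<in> P" if "\<phi> s a = \<phi> t a" for s t
    using add[of "-t" s] add[of "-t" t] zero that unfolding P_def by simp
  have Padd: "s + t \<in> P" if "s \<in> P" "t \<in> P" for s t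
    using add[of s t] that unfolding P_def by simp
  have Pneg: "- t \<in> P" if "t \<in> P" for t
    using diff[of 0 t] zero that unfolding P_def by simp
  have Pnat: "of_nat n * t \<in> P" if "t \<in> P" for n t
    by (induction n) (use zero Padd that in \<open>auto simp: P_def algebra_simps\<close>)
  have Pint: "of_int k * t \<in> P" if "t \<in> P" for k t
    using Pnat[OF that, of "nat k"] Pneg[OF Pnat[OF that, of "nat (- k)"]]
    by (cases "k \<ge> 0") auto
  have "closedin euclideanreal {t \<in> topspace euclideanreal. \<phi> t a \<in> {a}}"
    by (rule closedin_continuous_map_preimage[OF continuous_map_orbit[OF flow a]])
       (use assms a in \<open>auto intro: closedin_Hausdorff_singleton\<close>)
  then have "closed P"
    by (simp add: P_def)
  moreover have "t\<^sub>0 \<notin> P"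
    using assms by (simp add: P_def)
  ultimately obtain e where e: "e > 0" "\<And>t. t \<in> P \<Longrightarrow> e \<le> \<bar>t - t\<^sub>0\<bar>"
    by (metis closed_approachable dist_real_def not_le)
  have nosmall: "p \<notin> P" if "0 < p" "p < e" for p
  proof
    assume "p \<in> P"
    have "of_int \<lfloor>t\<^sub>0 / p\<rfloor> * p \<le> t\<^sub>0" "t\<^sub>0 < (of_int \<lfloor>t\<^sub>0 / p\<rfloor> + 1) * p"
      using \<open>0 < p\<close> floor_divide_lower floor_divide_upper by blast+
    then show False
      using e(2)[OF Pint[OF \<open>p \<in> P\<close>, of "\<lfloor>t\<^sub>0 / p\<rfloor>"]] that
      by (simp add: distrib_right)
  qed
  show ?thesis
  proof
    show "e > 0" by fact
    fix s t assume "\<phi> s a = \<phi> t a" and small: "\<bar>s - t\<bar> < e"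
    then have "\<bar>s - t\<bar> \<in> P"
      using diff[of s t] diff[of t s] by (cases "s \<ge> t") simp_all
    then have "\<not> 0 < \<bar>s - t\<bar>"
      using nosmall small by blast
    then show "s = t"
      by simp
  qed
qed

text \<open>The arc is the straight time segment from a time \<open>b\<close> in the frontier of the set of times spent in \<open>A\<close>
to a time outside this set that is too near for the orbit to return to a position in between.\<close>

lemma enough_arcs_minimal_flow:
  assumes nd: "nondegenerate_space X" and mt: "metrizable_space X" and min: "minimal_flow X \<phi>"
  shows "enough_arcs X"
  unfolding enough_arcs_def
proof (intro conjI allI impI nd mt)
  fix A assume A: "closedin X A \<and> A \<noteq> {} \<and> A \<noteq> topspace X"
  then obtain a where aA: "a \<in> A" and a: "a \<in> topspace X"
    using closedin_subset by blast
  have H: "Hausdorff_space X"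
    by (simp add: metrizable_imp_Hausdorff_space mt)
  have flow: "continuous_flow X \<phi>" and dense: "X closure_of (range (\<lambda>t. \<phi> t a)) = topspace X"
    using min a unfolding minimal_flow_def by auto
  have leaves: "\<exists>t. \<phi> t a \<notin> B" if "closedin X B" "B \<noteq> topspace X" for B
  proof (rule ccontr)
    assume "\<not> ?thesis"
    then have "range (\<lambda>t. \<phi> t a) \<subseteq> B" by blast
    from closure_of_minimal[OF this that(1)] show False
      using dense that closedin_subset[of X B] by auto
  qed
  obtain x y where "x \<in> topspace X" "y \<in> topspace X" "x \<noteq> y"
    using nd unfolding nondegenerate_space_def by blast
  then have "{a} \<noteq> topspace X"
    by (metis singletonD)
  moreover have "closedin X {a}"
    using H a by (simp add: closedin_Hausdorff_singleton)
  ultimately obtain t\<^sub>0 where "\<phi> t\<^sub>0 a \<noteq> a"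
    using leaves[of "{a}"] by auto
  then obtain p where p: "p > 0" "\<And>s t. \<lbrakk>\<phi> s a = \<phi> t a; \<bar>s - t\<bar> < p\<rbrakk> \<Longrightarrow> s = t"
    using nonfixed_orbit_locally_injective[OF flow H a] by metis
  define T where "T = {t. \<phi> t a \<in> A}"
  have "closedin euclideanreal {t \<in> topspace euclideanreal. \<phi> t a \<in> A}"
    by (rule closedin_continuous_map_preimage[OF continuous_map_orbit[OF flow a]]) (use A in auto)
  then have "closed T"
    by (simp add: T_def)
  moreover have "0 \<in> T"
    using flow a aA by (simp add: T_def continuous_flow_def)
  moreover have "T \<noteq> UNIV"
    using leaves A unfolding T_def by blast
  ultimately have "\<not> open T"
    using clopen by blast
  then obtain b where "b \<in> T" and near: "\<And>e. e > 0 \<Longrightarrow> \<exists>t. \<bar>t - b\<bar> < e \<and> t \<notin> T"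
    unfolding open_dist dist_real_def by metis
  obtain t where t: "\<bar>t - b\<bar> < p" "t \<notin> T"
    using near[OF \<open>p > 0\<close>] by blast
  define \<gamma> where "\<gamma> u = \<phi> (b + u * (t - b)) a" for u
  have "continuous_map (top_of_set {0..1}) euclideanreal (\<lambda>u. b + u * (t - b))"
    by (auto intro!: continuous_intros)
  from continuous_map_compose[OF this continuous_map_orbit[OF flow a]]
  have cont: "continuous_map (top_of_set {0..1}) X \<gamma>"
    by (simp add: \<gamma>_def[abs_def] o_def)
  have inj: "inj_on \<gamma> {0..1}"
  proof (rule inj_onI)
    fix u v :: real assume uv: "u \<in> {0..1}" "v \<in> {0..1}" "\<gamma> u = \<gamma> v"
    have "(b + u * (t - b)) - (b + v * (t - b)) = (u - v) * (t - b)"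
      by (simp add: algebra_simps)
    then have "\<bar>(b + u * (t - b)) - (b + v * (t - b))\<bar> = \<bar>u - v\<bar> * \<bar>t - b\<bar>"
      by (simp only: abs_mult)
    also have "\<dots> \<le> 1 * \<bar>t - b\<bar>"
      using uv by (intro mult_right_mono) auto
    finally have "b + u * (t - b) = b + v * (t - b)"
      using uv(3) t(1) unfolding \<gamma>_def by (intro p(2)) auto
    then show "u = v"
      using t \<open>b \<in> T\<close> by auto
  qed
  have "\<gamma> 1 \<in> topspace X"
    using continuous_map_image_subset_topspace[OF cont] by (simp add: image_subset_iff)
  then have "\<gamma> 0 \<in> A" "\<gamma> 1 \<in> topspace X - A"
    using \<open>b \<in> T\<close> t(2) by (simp_all add: \<gamma>_def T_def)
  with arc_in_with_endpoints_injective_path[OF H cont inj]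
  show "\<exists>C a b. arc_in_with_endpoints X C a b \<and> a \<in> A \<and> b \<in> topspace X - A"
    by blast
qed

section \<open>Continua with arcwise connected composants\<close>

text \<open>Choose an open \<open>V\<close> whose closure avoids \<open>A\<close>. The component of \<open>p\<close> in the complement of \<open>V\<close> is a proper
subcontinuum, and boundary bumping makes it reach the frontier of \<open>V\<close>, which is outside \<open>A\<close>.\<close>

lemma composant_escapes_closed:
  assumes X: "continuum X" "Hausdorff_space X" and A: "closedin X A" "A \<noteq> topspace X"
    and p: "p \<in> A"
  shows "\<exists>q \<in> composant X p. q \<notin> A"
proof -
  have conn: "connected_space X" and comp: "compact_space X"
    using X unfolding continuum_def by auto
  obtain c where c: "c \<in> topspace X - A"
    using A closedin_subset by blast
  have "regular_space X"
    using X comp compact_Hausdorff_imp_regular_space by blast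
  then obtain V where V: "openin X V" "c \<in> V" "disjnt A (X closure_of V)"
    using A c unfolding regular_space by meson
  define S where "S = topspace X - V"
  have S: "closedin X S" "S \<noteq> topspace X"
    using V openin_subset unfolding S_def by blast+
  have "V \<subseteq> X closure_of V"
    by (simp add: V closure_of_subset openin_subset)
  then have pS: "p \<in> topspace (subtopology X S)"
    using p V(3) closedin_subset[OF A(1)] unfolding S_def disjnt_iff by auto
  define C where "C = connected_component_of_set (subtopology X S) p"
  have C: "C \<in> connected_components_of (subtopology X S)"
    using pS unfolding C_def connected_components_of_def by blast
  from boundary_bumping_theorem_closed[OF conn comp X(2) S C]
  obtain q where q: "q \<in> C" "q \<in> X frontier_of S" by blast
  have "X frontier_of S \<subseteq> X closure_of V"
    using V(1) unfolding S_def frontier_of_complement by (simp add: frontier_of_def Diff_subset)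
  then have "q \<notin> A"
    using q V(3) unfolding disjnt_iff by blast
  have "closedin (subtopology X S) C"
    using C closedin_connected_components_of by blast
  then have "closedin X C"
    using S closedin_trans_full by blast
  have "C \<subseteq> S"
    using connected_components_of_subset[OF C] by simp
  have "connectedin X C"
    using C connectedin_connected_components_of connectedin_subtopology by blast
  then have "subcontinuum X C"
    unfolding subcontinuum_def continuum_def
    using \<open>closedin X C\<close> q comp
    by (auto simp: connectedin_def compact_space_subtopology closedin_compact_space)
  moreover have "C \<noteq> topspace X"
    using \<open>C \<subseteq> S\<close> S closedin_subset by blast
  moreover have "p \<in> C"
    using pS unfolding C_def by (simp add: connected_component_of_refl)
  ultimately have "q \<in> composant X p"
    using q unfolding composant_def by blast
  with \<open>q \<notin> A\<close> show ?thesis by blast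
qed

lemma enough_arcs_arcwise_connected_composants:
  assumes nd: "nondegenerate_space X" and mt: "metrizable_space X" and X: "continuum X"
    and arcs: "\<And>p. p \<in> topspace X \<Longrightarrow> arcwise_connected_space (subtopology X (composant X p))"
  shows "enough_arcs X"
  unfolding enough_arcs_def
proof (intro conjI allI impI nd mt)
  fix A assume A: "closedin X A \<and> A \<noteq> {} \<and> A \<noteq> topspace X"
  then obtain p where p: "p \<in> A" "p \<in> topspace X"
    using closedin_subset by blast
  obtain q where q: "q \<in> composant X p" "q \<notin> A"
    using composant_escapes_closed[OF X] A p mt metrizable_imp_Hausdorff_space by metis
  have sub: "composant X p \<subseteq> topspace X"
    unfolding composant_def subcontinuum_def by blast
  have "p \<in> composant X p"
    using q unfolding composant_def by blast
  moreover have "p \<noteq> q"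
    using p q by blast
  ultimately obtain C where "arc_in_with_endpoints (subtopology X (composant X p)) C p q"
    using arcs[OF p(2)] q sub p(2) unfolding arcwise_connected_space_def topspace_subtopology
    by blast
  then show "\<exists>C a b. arc_in_with_endpoints X C a b \<and> a \<in> A \<and> b \<in> topspace X - A"
    using arc_in_with_endpoints_subtopology[of X _ C p q] p q sub
    by (intro exI[of _ C] exI[of _ p] exI[of _ q]) auto
qed

section \<open>Lifting arcs through open maps on the line\<close>

text \<open>That both tails of the line are mapped onto the whole space takes over the role that compactness of
the domain has for open maps between compact spaces: it rules out that a lift escapes to infinity
before the end of the arc is reached.\<close>

definition open_winding_map :: "'a topology \<Rightarrow> (real \<Rightarrow> 'a) \<Rightarrow> bool" where
  "open_winding_map X q \<longleftrightarrow> continuous_map euclideanreal X q \<and> open_map euclideanreal X q \<and>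
     (\<forall>t. q ` {t..} = topspace X \<and> q ` {..t} = topspace X)"

lemma open_winding_map_compose:
  assumes q: "open_winding_map X q" and f: "continuous_map X Y f" "open_map X Y f"
    and surj: "f ` topspace X = topspace Y"
  shows "open_winding_map Y (f \<circ> q)"
proof -
  have "(f \<circ> q) ` {t..} = topspace Y" "(f \<circ> q) ` {..t} = topspace Y" for t
    using q surj unfolding open_winding_map_def image_comp[symmetric] by simp_all
  then show ?thesis
    using q f unfolding open_winding_map_def
    by (auto intro: continuous_map_compose open_map_compose)
qed

text \<open>Each component \<open>C\<close> of the preimage of \<open>J\<close> is mapped onto \<open>J\<close>. An unbounded component contains a tail of the
line. If a bounded one missed \<open>z\<close>, then so would a compact relatively clopen neighbourhood \<open>K\<close> of it in the
preimage (Sura-Bura); but the image of \<open>K\<close> is clopen in the connected set \<open>J\<close>, by compactness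
of \<open>K\<close> and openness of the map.\<close>

lemma component_of_preimage_onto:
  assumes "Hausdorff_space Z" and F: "open_winding_map Z F"
    and J: "closedin Z J" "connectedin Z J"
    and x: "F x \<in> J" and z: "z \<in> J"
  obtains y where "F ` closed_segment x y \<subseteq> J" "F y = z"
proof -
  have cont: "continuous_map euclideanreal Z F" and opn: "open_map euclideanreal Z F"
    and tails: "F ` {t..} = topspace Z" "F ` {..t} = topspace Z" for t
    using F unfolding open_winding_map_def by auto
  have "z \<in> topspace Z"
    using J z closedin_subset by blast
  define W where "W = {t. F t \<in> J}"
  have closed_preimage: "closed {t. F t \<in> B}" if "closedin Z B" for B
    using closedin_continuous_map_preimage[OF cont that] by simp
  have "closed W"
    unfolding W_def by (rule closed_preimage) fact
  define C where "C = connected_component_set W x"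
  have CW: "C \<subseteq> W" and "connected C"
    unfolding C_def by (simp_all add: connected_component_subset)
  have xC: "x \<in> C"
    using x unfolding C_def W_def by (simp add: connected_component_refl)
  have compC: "C \<in> components W"
    using x unfolding C_def W_def by (auto simp: components_def)
  have between: "{u..v} \<subseteq> C" if "u \<in> C" "v \<in> C" for u v
    using connected_contains_Icc[OF \<open>connected C\<close>] that by blast
  have "\<exists>y \<in> C. F y = z"
  proof (cases "bounded C")
    case False
    then consider "\<not> bdd_above C" | "\<not> bdd_below C"
      using bounded_closed_interval bounded_subset unfolding bdd_above_def bdd_below_def
      by (metis atLeastAtMost_iff subsetI)
    then show ?thesis
    proof cases
      case 1
      then have "{x..} \<subseteq> C"
        using between[OF xC] unfolding bdd_above_def
        by (metis atLeastAtMost_iff atLeast_iff linear subset_iff)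
      then show ?thesis
        using tails(1)[of x] \<open>z \<in> topspace Z\<close> by (metis imageE subsetD)
    next
      case 2
      then have "{..x} \<subseteq> C"
        using between[OF _ xC] unfolding bdd_below_def
        by (metis atLeastAtMost_iff atMost_iff linear subset_iff)
      then show ?thesis
        using tails(2)[of x] \<open>z \<in> topspace Z\<close> by (metis imageE subsetD)
    qed
  next
    case True
    then have "compact C"
      using \<open>closed W\<close> closed_connected_component[of W x]
      unfolding C_def compact_eq_bounded_closed by blast
    define D where "D = {t. F t \<in> {z}}"
    have "closed D"
      unfolding D_def using assms(1) \<open>z \<in> topspace Z\<close>
      by (intro closed_preimage) (simp add: closedin_Hausdorff_singleton)
    show ?thesis
    proof (rule ccontr)
      assume "\<not> ?thesis"
      then have CD: "C \<subseteq> - D"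
        unfolding D_def by auto
      have "locally compact W"
        using \<open>closed W\<close> closed_imp_locally_compact by blast
      moreover have "open (- D)"
        using \<open>closed D\<close> by (simp add: open_Compl)
      ultimately obtain K where K: "openin (top_of_set W) K" "compact K" "C \<subseteq> K" "K \<subseteq> - D"
        using Sura_Bura_clopen_subset compC \<open>compact C\<close> CD by metis
      obtain V where V: "open V" "K = W \<inter> V"
        using K(1) openin_open by metis
      \<comment> \<open>Openness passes to the restriction to a full preimage.\<close>
      have "F ` K = F ` V \<inter> J"
        unfolding V W_def by blast
      moreover have "openin Z (F ` V)"
        using opn V unfolding open_map_def by simp
      ultimately have "openin (subtopology Z J) (F ` K)"
        by (simp add: openin_subtopology_Int)
      moreover have "compactin Z (F ` K)"
        using image_compactin[OF _ cont] K(2) by simp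
      then have "closedin Z (F ` K)"
        using assms(1) compactin_imp_closedin by blast
      then have "closedin (subtopology Z J) (F ` K)"
        using \<open>F ` K = F ` V \<inter> J\<close> by (auto intro: closedin_subset_topspace)
      moreover have "connected_space (subtopology Z J)" "topspace (subtopology Z J) = J"
        using J closedin_subset by (auto simp: connectedin_def)
      moreover have "F ` K \<noteq> {}"
        using xC K by blast
      ultimately have "F ` K = J"
        using connected_space_clopen_in by metis
      then show False
        using z K(4) unfolding D_def by auto
    qed
  qed
  then obtain y where y: "y \<in> C" "F y = z" by blast
  have "closed_segment x y \<subseteq> C"
    using between[OF xC y(1)] between[OF y(1) xC] by (auto simp: closed_segment_eq_real_ivl)
  then show ?thesis
    using that[of y] y CW unfolding W_def by auto
qed

text \<open>If \<open>G\<close> failed to increase from \<open>s\<close> to \<open>t\<close>, its maximum over \<open>[0, t]\<close> would be attained in the interior. For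
suppose that it is attained at an endpoint: neither \<open>G 0\<close> nor \<open>G t\<close> exceeds \<open>G s\<close>, so \<open>s\<close> attains it as well,
and if \<open>s = 0\<close> then \<open>G\<close> is constant on \<open>[0, t]\<close>.\<close>

lemma continuous_no_interior_maximum_strict_mono:
  fixes G :: "real \<Rightarrow> real"
  assumes cont: "continuous_on {0..1} G" and low: "\<And>t. t \<in> {0..1} \<Longrightarrow> G 0 \<le> G t"
    and nomax: "\<And>s t. \<lbrakk>0 < s; s < t; t \<le> 1\<rbrakk> \<Longrightarrow> \<exists>r \<in> {0<..<t}. G s < G r"
  shows "strict_mono_on {0..1} G"
proof (rule strict_mono_onI, rule ccontr)
  fix s t :: real assume st: "s \<in> {0..1}" "t \<in> {0..1}" "s < t" "\<not> G s < G t"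
  have "continuous_on {0..t} G"
    by (rule continuous_on_subset[OF cont]) (use st in auto)
  then obtain m where m: "m \<in> {0..t}" "\<And>r. r \<in> {0..t} \<Longrightarrow> G r \<le> G m"
    using continuous_attains_sup[of "{0..t}" G] st by auto
  have "\<exists>s' \<in> {0<..<t}. \<forall>r \<in> {0..t}. G r \<le> G s'"
  proof (cases "m \<in> {0<..<t}")
    case True
    then show ?thesis using m by blast
  next
    case False
    then consider "m = 0" | "m = t" using m by fastforce
    then have "G m \<le> G s"
      using low[OF st(1)] st by cases auto
    show ?thesis
    proof (cases "s = 0")
      case True
      \<comment> \<open>Here \<open>G\<close> is constant on \<open>[0, t]\<close>, so that any interior point will do.\<close>
      have "G r \<le> G (t / 2)" if "r \<in> {0..t}" for r
        using m(2)[OF that] \<open>G m \<le> G s\<close> True low[of "t / 2"] st by auto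
      then show ?thesis using st by (intro bexI[of _ "t / 2"]) auto
    next
      case False
      then show ?thesis
        using m \<open>G m \<le> G s\<close> st by (intro bexI[of _ s]) force+
    qed
  qed
  then obtain s' where "s' \<in> {0<..<t}" "\<And>r. r \<in> {0..t} \<Longrightarrow> G r \<le> G s'" by blast
  then show False
    using nomax[of s' t] st by (meson atLeastAtMost_iff greaterThanLessThan_iff less_imp_le not_le)
qed

text \<open>Follow the segment from \<open>x\<close>, inside the preimage of the arc, only up to the first point over \<open>\<gamma> 1\<close>. Its
image, read off in the parameter of \<open>\<gamma>\<close>, is a function \<open>G\<close> on the unit interval with values below 1 before
time 1. Openness of \<open>F\<close> forbids an interior maximum with a value below 1, so \<open>G\<close> is strictly increasing, and
reparametrising the segment by the inverse of \<open>G\<close> gives the lift.\<close>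

lemma arc_lift_to_line:
  assumes Z: "Hausdorff_space Z" and F: "open_winding_map Z F"
    and \<gamma>: "continuous_map (top_of_set {0..1::real}) Z \<gamma>" "inj_on \<gamma> {0..1}" and x: "F x = \<gamma> 0"
  obtains \<sigma> where "continuous_on {0..1} \<sigma>" "\<sigma> 0 = x" "\<And>u. u \<in> {0..1} \<Longrightarrow> F (\<sigma> u) = \<gamma> u"
proof -
  have cont: "continuous_map euclideanreal Z F" and opn: "open_map euclideanreal Z F"
    using F unfolding open_winding_map_def by auto
  define J where "J = \<gamma> ` {0..1}"
  have J: "closedin Z J" "connectedin Z J"
  proof -
    have "compactin Z J"
      unfolding J_def by (rule image_compactin[OF _ \<gamma>(1)]) (simp add: compactin_subtopology)
    with Z show "closedin Z J"
      by (rule compactin_imp_closedin)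
    show "connectedin Z J"
      unfolding J_def
      by (rule connectedin_continuous_map_image[OF \<gamma>(1)]) (simp add: connectedin_subtopology)
  qed
  have ends: "F x \<in> J" "\<gamma> 1 \<in> J"
    using x by (auto simp: J_def)
  then obtain y where y: "F ` closed_segment x y \<subseteq> J" "F y = \<gamma> 1"
    using component_of_preimage_onto[OF Z F J] by metis
  define l where "l t = x + t * (y - x)" for t
  have l01: "l t \<in> closed_segment x y" if "t \<in> {0..1}" for t
    using that unfolding l_def in_segment by (intro exI[of _ t]) (auto simp: algebra_simps)
  define E where "E = {t \<in> {0..1}. F (l t) \<in> {\<gamma> 1}}"
  have contl: "continuous_map euclideanreal Z (F \<circ> l)"
    by (rule continuous_map_compose[OF _ cont]) (auto simp: l_def intro!: continuous_intros)
  have "\<gamma> 1 \<in> topspace Z"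
    using J ends closedin_subset by blast
  then have "closedin Z {\<gamma> 1}"
    by (simp add: Z closedin_Hausdorff_singleton)
  from closedin_continuous_map_preimage[OF contl this]
  have "closed {t. F (l t) \<in> {\<gamma> 1}}"
    by simp
  then have "compact ({0..1} \<inter> {t. F (l t) \<in> {\<gamma> 1}})"
    by (intro compact_Int_closed) auto
  moreover have "{0..1} \<inter> {t. F (l t) \<in> {\<gamma> 1}} = E"
    unfolding E_def by auto
  moreover have "1 \<in> E"
    using y unfolding E_def l_def by simp
  ultimately obtain e where e: "e \<in> E" "\<And>t. t \<in> E \<Longrightarrow> e \<le> t"
    using compact_attains_inf[of E] by (metis empty_iff)
  have "\<gamma> 0 \<noteq> \<gamma> 1"
    using inj_onD[OF \<gamma>(2), of 0 1] by auto
  then have "e > 0" "x \<noteq> y"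
    using e(1) x y(2) unfolding E_def l_def by (auto simp: order.order_iff_strict)
  have "e \<le> 1"
    using e(1) unfolding E_def by simp
  \<comment> \<open>\<open>h\<close> runs linearly from \<open>x\<close> to the first point over \<open>\<gamma> 1\<close>.\<close>
  define c where "c = e * (y - x)"
  have "c \<noteq> 0"
    using \<open>e > 0\<close> \<open>x \<noteq> y\<close> unfolding c_def by simp
  define h where "h t = x + c * t" for t
  have hl: "h t = l (e * t)" for t
    unfolding h_def l_def c_def by (simp add: algebra_simps)
  have et: "e * t \<in> {0..1}" if "t \<in> {0..1}" for t
    using that \<open>e > 0\<close> \<open>e \<le> 1\<close> by (auto intro: mult_le_one)
  have hJ: "F (h t) \<in> J" if "t \<in> {0..1}" for t
    using y(1) l01[OF et[OF that]] unfolding hl by blast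
  have first: "t = 1" if "t \<in> {0..1}" "F (h t) = \<gamma> 1" for t
  proof -
    have "e * t \<in> E"
      using et[OF that(1)] that(2) unfolding E_def hl by simp
    then show ?thesis
      using e(2)[of "e * t"] \<open>e > 0\<close> that(1) by auto
  qed
  have h1: "F (h 1) = \<gamma> 1"
    using e(1) unfolding E_def hl by simp
  obtain g where g: "homeomorphic_maps (top_of_set {0..1}) (subtopology Z J) \<gamma> g"
  proof -
    have "homeomorphic_map (top_of_set {0..1}) (subtopology Z J) \<gamma>"
      using \<gamma> Z J(1) closedin_subset[OF J(1)] unfolding J_def
      by (intro continuous_imp_homeomorphic_map)
         (auto simp: continuous_map_in_subtopology compact_space_subtopology Hausdorff_space_subtopology)
    then show ?thesis
      using that homeomorphic_map_maps by blast
  qed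
  have contg: "continuous_map (subtopology Z J) (top_of_set {0..1}) g"
    and g\<gamma>: "\<And>u. u \<in> {0..1} \<Longrightarrow> g (\<gamma> u) = u"
    using g unfolding homeomorphic_maps_def by auto
  have \<gamma>g: "g w \<in> {0..1}" "\<gamma> (g w) = w" if "w \<in> J" for w
    using g\<gamma> that unfolding J_def by auto
  define G where "G t = g (F (h t))" for t
  have "continuous_map (top_of_set {0..1}) (subtopology Z J) (F \<circ> h)"
    using hJ by (auto simp: continuous_map_in_subtopology h_def
        intro!: continuous_map_compose[OF _ cont] continuous_intros)
  from continuous_map_compose[OF this contg] have contG: "continuous_on {0..1} G"
    by (simp add: G_def[abs_def] o_def continuous_map_in_subtopology)
  have G01: "G t \<in> {0..1}" and \<gamma>G: "\<gamma> (G t) = F (h t)" if "t \<in> {0..1}" for t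
    using \<gamma>g hJ[OF that] unfolding G_def by auto
  have G0: "G 0 = 0" and G1: "G 1 = 1"
    using g\<gamma> x h1 unfolding G_def by (auto simp: h_def)
  have smono: "strict_mono_on {0..1} G"
  proof (rule continuous_no_interior_maximum_strict_mono[OF contG])
    show "G 0 \<le> G t" if "t \<in> {0..1}" for t
      using G0 G01[OF that] by simp
  next
    fix s t :: real assume st: "0 < s" "s < t" "t \<le> 1"
    have "G s \<noteq> 1"
      using first[of s] \<gamma>G[of s] st by auto
    then have "G s < 1"
      using G01[of s] st by auto
    define O' where "O' = {u \<in> {0..1}. \<gamma> u \<in> F ` h ` {0<..<t}}"
    have "open (h ` {0<..<t})"
      using open_affinity[of "{0<..<t}" c x] \<open>c \<noteq> 0\<close> by (simp add: h_def[abs_def])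
    then have "openin Z (F ` h ` {0<..<t})"
      using opn unfolding open_map_def by simp
    from openin_continuous_map_preimage[OF \<gamma>(1) this]
    have "openin (top_of_set {0..1}) O'"
      by (simp add: O'_def)
    moreover have "G s \<in> O'"
      using G01[of s] \<gamma>G[of s] st unfolding O'_def by auto
    ultimately obtain d where d: "d > 0" "\<And>u. \<lbrakk>u \<in> {0..1}; dist u (G s) < d\<rbrakk> \<Longrightarrow> u \<in> O'"
      unfolding openin_euclidean_subtopology_iff by metis
    \<comment> \<open>The open image contains \<open>\<gamma> (G s)\<close>, hence also \<open>\<gamma> u\<close> for parameters \<open>u\<close> slightly above \<open>G s\<close>.\<close>
    define u where "u = min 1 (G s + d / 2)"
    have u: "u \<in> {0..1}" "G s < u" "dist u (G s) < d"
      using \<open>G s < 1\<close> \<open>d > 0\<close> G01[of s] st unfolding u_def dist_real_def by auto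
    then obtain r where r: "r \<in> {0<..<t}" "\<gamma> u = F (h r)"
      using d(2)[OF u(1,3)] unfolding O'_def by auto
    then have "G r = u"
      using g\<gamma>[OF u(1)] unfolding G_def by simp
    then show "\<exists>r\<in>{0<..<t}. G s < G r"
      using r u by blast
  qed
  have inj: "inj_on G {0..1}"
    using smono strict_mono_on_imp_inj_on by blast
  have onto: "G ` {0..1} = {0..1}"
  proof
    show "G ` {0..1} \<subseteq> {0..1}"
      using G01 by blast
    show "{0..1} \<subseteq> G ` {0..1}"
      using IVT'[of G 0 _ 1] contG G0 G1 by fastforce
  qed
  define k where "k = inv_into {0..1} G"
  have k: "k u \<in> {0..1}" "G (k u) = u" if "u \<in> {0..1}" for u
    using that onto inv_into_into[of u G "{0..1}"] f_inv_into_f[of u G "{0..1}"]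
    unfolding k_def by auto
  have "continuous_on (G ` {0..1}) k"
    by (rule continuous_on_inv[OF contG]) (simp_all add: k_def inv_into_f_f[OF inj])
  then have contk: "continuous_on {0..1} k"
    by (simp add: onto)
  show ?thesis
  proof
    show "continuous_on {0..1} (\<lambda>u. h (k u))"
      unfolding h_def by (intro continuous_intros contk)
    have "k 0 = 0"
      using inv_into_f_f[OF inj, of 0] G0 unfolding k_def by simp
    then show "h (k 0) = x"
      by (simp add: h_def)
    show "F (h (k u)) = \<gamma> u" if "u \<in> {0..1}" for u
      using \<gamma>G[OF k(1)[OF that]] k(2)[OF that] by simp
  qed
qed

text \<open>Choosing a point of the line over \<open>y\<close> reduces the lifting through \<open>f\<close> to the lifting through \<open>f \<circ> q\<close>. A
lift of an injective path is injective.\<close>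

lemma arc_lift:
  assumes Z: "Hausdorff_space Z" and q: "open_winding_map Y q"
    and F: "open_winding_map Z (f \<circ> q)"
    and \<gamma>: "continuous_map (top_of_set {0..1::real}) Z \<gamma>" "inj_on \<gamma> {0..1}"
    and y: "y \<in> topspace Y" "f y = \<gamma> 0"
  obtains \<delta> where "continuous_map (top_of_set {0..1}) Y \<delta>" "inj_on \<delta> {0..1}" "\<delta> 0 = y"
    "\<And>u. u \<in> {0..1} \<Longrightarrow> f (\<delta> u) = \<gamma> u"
proof -
  have "q ` {0..} = topspace Y" and contq: "continuous_map euclideanreal Y q"
    using q unfolding open_winding_map_def by auto
  then obtain x where x: "q x = y"
    using y(1) by (metis imageE)
  obtain \<sigma> where \<sigma>: "continuous_on {0..1} \<sigma>" "\<sigma> 0 = x" "\<And>u. u \<in> {0..1} \<Longrightarrow> (f \<circ> q) (\<sigma> u) = \<gamma> u"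
    using arc_lift_to_line[OF Z F \<gamma>, of x] x y(2) by auto
  show ?thesis
  proof
    show "continuous_map (top_of_set {0..1}) Y (q \<circ> \<sigma>)"
      by (rule continuous_map_compose[OF _ contq]) (simp add: \<sigma>(1))
    show "(q \<circ> \<sigma>) 0 = y"
      using \<sigma>(2) x by simp
    show lift: "f ((q \<circ> \<sigma>) u) = \<gamma> u" if "u \<in> {0..1}" for u
      using \<sigma>(3)[OF that] by simp
    show "inj_on (q \<circ> \<sigma>) {0..1}"
      by (rule inj_onI) (metis lift inj_onD[OF \<gamma>(2)])
  qed
qed

section \<open>Circles and arcs as open images of the line\<close>

text \<open>A nonconstant entire function is open, and it stays open when restricted to the full preimage of a set;
here that preimage is the real axis. The period \<open>2 * pi\<close> makes each tail as good as the whole line.\<close>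

lemma entire_restricted_to_reals_open_winding_map:
  assumes holo: "h holomorphic_on UNIV"
    and pre: "\<And>w. h w \<in> Z \<Longrightarrow> w \<in> \<real>" and onto: "range (\<lambda>t. h (complex_of_real t)) = Z"
    and periodic: "\<And>w. h (w + of_real (2 * pi)) = h w"
    and nonconst: "h a \<noteq> h b"
  shows "open_winding_map (top_of_set Z) (\<lambda>t. h (complex_of_real t))" (is "open_winding_map _ ?q")
  unfolding open_winding_map_def
proof (intro conjI allI)
  have conth: "continuous_on UNIV h"
    using holo by (rule holomorphic_on_imp_continuous_on)
  have "continuous_on UNIV ?q"
    by (rule continuous_on_compose2[OF conth]) (auto intro!: continuous_intros)
  then show "continuous_map euclideanreal (top_of_set Z) ?q"
    using onto by (auto simp: continuous_map_in_subtopology)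
  show "open_map euclideanreal (top_of_set Z) ?q"
    unfolding open_map_def
  proof (intro allI impI)
    fix U assume "openin euclideanreal U"
    then have "open (Re -` U)"
      by (simp add: open_vimage continuous_on_Re)
    moreover have "\<not> h constant_on UNIV"
      using nonconst unfolding constant_on_def by (metis UNIV_I)
    ultimately have "open (h ` (Re -` U))"
      using open_mapping_thm[OF holo open_UNIV connected_UNIV] by blast
    moreover have "?q ` U = Z \<inter> h ` (Re -` U)"
    proof
      show "?q ` U \<subseteq> Z \<inter> h ` (Re -` U)"
        using onto by (auto intro!: imageI)
      show "Z \<inter> h ` (Re -` U) \<subseteq> ?q ` U"
      proof
        fix z assume "z \<in> Z \<inter> h ` (Re -` U)"
        then obtain w where "Re w \<in> U" "z = h w" "w \<in> \<real>"
          using pre by blast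
        then show "z \<in> ?q ` U"
          by (auto elim!: Reals_cases)
      qed
    qed
    ultimately show "openin (top_of_set Z) (?q ` U)"
      by (simp add: openin_open_Int)
  qed
  have per: "?q (t + of_int k * (2 * pi)) = ?q t" for t and k :: int
  proof -
    have nat: "?q (t + of_nat n * (2 * pi)) = ?q t" for t and n :: nat
    proof (induction n)
      case (Suc n)
      then show ?case
        using periodic[of "of_real (t + of_nat n * (2 * pi))"] by (simp add: algebra_simps)
    qed simp
    show ?thesis
      using nat[of t "nat k"] nat[of "t + of_int k * (2 * pi)" "nat (- k)"]
      by (cases "k \<ge> 0") auto
  qed
  fix t :: real
  have "\<exists>r \<ge> t. ?q r = ?q s" "\<exists>r \<le> t. ?q r = ?q s" for s
  proof -
    \<comment> \<open>Shift \<open>s\<close> by the multiple of the period that just reaches \<open>t\<close>, from above and then from below.\<close>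
    have "s + of_int \<lceil>(t - s) / (2 * pi)\<rceil> * (2 * pi) \<ge> t"
      using ceiling_divide_upper[of "2 * pi" "t - s"] by simp
    then show "\<exists>r \<ge> t. ?q r = ?q s"
      using per by blast
    have "s + of_int \<lfloor>(t - s) / (2 * pi)\<rfloor> * (2 * pi) \<le> t"
      using floor_divide_lower[of "2 * pi" "t - s"] by simp
    then show "\<exists>r \<le> t. ?q r = ?q s"
      using per by blast
  qed
  then show "?q ` {t..} = topspace (top_of_set Z)" "?q ` {..t} = topspace (top_of_set Z)"
    unfolding onto[symmetric] by (auto simp: image_iff) (metis atLeast_iff, metis atMost_iff)
qed

lemma open_winding_map_circle:
  "open_winding_map (top_of_set (sphere (0::complex) 1)) (\<lambda>t. exp (\<i> * complex_of_real t))"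
proof (rule entire_restricted_to_reals_open_winding_map[where a = 0 and b = "of_real pi"])
  show "(\<lambda>w. exp (\<i> * w)) holomorphic_on UNIV"
    by (intro holomorphic_intros)
  show "w \<in> \<real>" if "exp (\<i> * w) \<in> sphere 0 1" for w
    using that norm_exp_imaginary[of "\<i> * w"] by (simp add: complex_is_Real_iff)
  show "range (\<lambda>t. exp (\<i> * complex_of_real t)) = sphere 0 1"
    by (auto simp: image_iff elim!: complex_unimodular_polar) (metis complex_unimodular_polar cis_conv_exp cis.ctr)
  show "exp (\<i> * (w + of_real (2 * pi))) = exp (\<i> * w)" for w
    by (simp add: distrib_left exp_add mult.assoc) (metis exp_two_pi_i mult.commute mult.assoc mult_1)
qed (simp add: mult.commute[of \<i>])

lemma open_winding_map_segment:
  "open_winding_map (top_of_set (closed_segment (- 1) (1::complex))) (\<lambda>t. cos (complex_of_real t))"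
proof -
  have seg: "closed_segment (- 1) (1::complex) = of_real ` {-1..1}"
    using closed_segment_of_real[of "-1" 1, where 'a=complex] by (simp add: closed_segment_eq_real_ivl)
  show ?thesis
  proof (rule entire_restricted_to_reals_open_winding_map[where a = 0 and b = "of_real pi"])
    show "cos holomorphic_on UNIV"
      by (rule holomorphic_on_cos)
    show "w \<in> \<real>" if w: "cos w \<in> closed_segment (- 1) 1" for w :: complex
    proof -
      obtain r where "r \<in> {-1..1}" "cos w = of_real r"
        using w unfolding seg by blast
      then have "cos w = cos (of_real (arccos r))"
        by (simp add: cos_of_real)
      then show ?thesis
        unfolding complex_cos_eq by (auto elim!: Ints_cases)
    qed
    show "range (\<lambda>t. cos (complex_of_real t)) = closed_segment (- 1) 1"
    proof -
      have "r \<in> range cos" if "r \<in> {-1..1}" for r :: real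
        using that by (intro image_eqI[of _ _ "arccos r"]) auto
      then have "range cos = {-1..1::real}"
        by auto
      then show ?thesis
        unfolding seg cos_of_real by (metis image_image)
    qed
    show "cos (w + of_real (2 * pi)) = cos w" for w :: complex
      by (subst complex_cos_eq) (auto intro!: bexI[of _ 1])
  qed simp
qed

lemma arcwise_connected_space_top_of_set:
  fixes S :: "complex set"
  assumes "path_connected S"
  shows "arcwise_connected_space (top_of_set S)"
  unfolding arcwise_connected_space_def
proof (intro ballI impI)
  fix x y assume "x \<in> topspace (top_of_set S)" "y \<in> topspace (top_of_set S)" "x \<noteq> y"
  then obtain g where "arc g" "path_image g \<subseteq> S" "pathstart g = x" "pathfinish g = y"
    using assms unfolding path_connected_arcwise by fastforce
  then show "\<exists>C. arc_in_with_endpoints (top_of_set S) C x y"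
    using arc_in_with_endpoints_injective_path[of "top_of_set S" g]
    unfolding arc_def path_def path_image_def pathstart_def pathfinish_def
    by (auto simp: continuous_map_in_subtopology Hausdorff_space_subtopology)
qed

lemma arcwise_connected_space_homeomorphic:
  assumes "X homeomorphic_space Y" "arcwise_connected_space X"
  shows "arcwise_connected_space Y"
proof -
  obtain k where k: "homeomorphic_map X Y k"
    using assms(1) homeomorphic_space by blast
  then have kX: "topspace Y = k ` topspace X"
    using homeomorphic_imp_surjective_map by blast
  show ?thesis
    unfolding arcwise_connected_space_def
  proof (intro ballI impI)
    fix x y assume "x \<in> topspace Y" "y \<in> topspace Y" "x \<noteq> y"
    then obtain a b where "a \<in> topspace X" "b \<in> topspace X" "a \<noteq> b" "x = k a" "y = k b"
      unfolding kX by blast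
    then show "\<exists>C. arc_in_with_endpoints Y C x y"
      using assms(2) arc_in_with_endpoints_homeomorphic_image[OF k]
      unfolding arcwise_connected_space_def by metis
  qed
qed

text \<open>What the inverse limit argument uses about its factor spaces, which are circles in one case and
arcs in the other.\<close>

definition arc_winding_space :: "'a topology \<Rightarrow> bool" where
  "arc_winding_space X \<longleftrightarrow> nondegenerate_space X \<and> metrizable_space X \<and> compact_space X \<and>
     arcwise_connected_space X \<and> (\<exists>q. open_winding_map X q)"

lemma arc_winding_space_homeomorphic:
  assumes "top_of_set Z homeomorphic_space X" and q: "open_winding_map (top_of_set Z) q"
    and Z: "compact Z" "path_connected Z" "u \<in> Z" "v \<in> Z" "u \<noteq> (v::complex)"
  shows "arc_winding_space X"
proof -
  obtain k where k: "homeomorphic_map (top_of_set Z) X k"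
    using assms(1) homeomorphic_space by blast
  have "open_winding_map X (k \<circ> q)"
    using q homeomorphic_imp_continuous_map[OF k] homeomorphic_imp_open_map[OF k]
      homeomorphic_imp_surjective_map[OF k] by (rule open_winding_map_compose)
  moreover have "nondegenerate_space X"
    unfolding nondegenerate_space_def
  proof (intro bexI)
    show "k u \<noteq> k v"
      using homeomorphic_imp_injective_map[OF k] Z by (auto dest: inj_onD)
    show "k u \<in> topspace X" "k v \<in> topspace X"
      using homeomorphic_imp_surjective_map[OF k] Z by auto
  qed
  moreover have "metrizable_space X"
    using assms(1) homeomorphic_metrizable_space metrizable_space_euclidean metrizable_space_subtopology
    by blast
  moreover have "compact_space X"
    using homeomorphic_compact_space[OF assms(1)] Z(1) by (simp add: compact_space_subtopology)
  ultimately show ?thesis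
    using arcwise_connected_space_homeomorphic[OF assms(1)] arcwise_connected_space_top_of_set Z(2)
    unfolding arc_winding_space_def by blast
qed

lemma arc_winding_space_circle:
  assumes "circle_space X"
  shows "arc_winding_space X"
proof (rule arc_winding_space_homeomorphic[OF _ open_winding_map_circle])
  show "top_of_set (sphere (0::complex) 1) homeomorphic_space X"
    using assms homeomorphic_space_sym unfolding circle_space_def by metis
  show "path_connected (sphere (0::complex) 1)"
    by (rule path_connected_sphere) simp
  show "1 \<in> sphere (0::complex) 1" "-1 \<in> sphere (0::complex) 1" "1 \<noteq> (-1::complex)"
    by auto
qed simp

lemma arc_winding_space_arc:
  assumes "arc_space X"
  shows "arc_winding_space X"
proof (rule arc_winding_space_homeomorphic[OF _ open_winding_map_segment, where u = "-1" and v = 1])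
  have "homeomorphic_map (top_of_set {0..1}) (top_of_set (closed_segment (- 1) (1::complex))) (linepath (- 1) 1)"
    by (rule continuous_imp_homeomorphic_map)
       (auto simp: continuous_map_in_subtopology compact_space_subtopology linepath_image_01
          linepath_in_path Hausdorff_space_subtopology inj_on_linepath)
  then have "top_of_set {0..1::real} homeomorphic_space top_of_set (closed_segment (- 1) (1::complex))"
    using homeomorphic_map_imp_homeomorphic_space by blast
  then show "top_of_set (closed_segment (- 1) (1::complex)) homeomorphic_space X"
    using assms unfolding arc_space_def by (metis homeomorphic_space_trans homeomorphic_space_sym)
qed (auto intro: convex_imp_path_connected)

section \<open>Inverse limits\<close>

text \<open>The image is open, and closed by compactness, in a space that is connected as an image of the line.\<close>

lemma open_map_arc_winding_spaces_surjective:
  assumes "arc_winding_space X" "arc_winding_space Y" "continuous_map X Y f" "open_map X Y f"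
  shows "f ` topspace X = topspace Y"
proof -
  obtain q where q: "open_winding_map Y q"
    using assms(2) unfolding arc_winding_space_def by blast
  have "connectedin Y (q ` UNIV)"
    using q unfolding open_winding_map_def
    by (metis connectedin_continuous_map_image connectedin_iff_connected connected_UNIV)
  moreover have "q ` UNIV = topspace Y"
    using q unfolding open_winding_map_def
    by (metis continuous_map_image_subset_topspace image_mono subset_UNIV subset_antisym topspace_euclidean)
  ultimately have "connected_space Y"
    by (simp add: connectedin_topspace)
  moreover have "openin Y (f ` topspace X)"
    using assms(4) unfolding open_map_def by simp
  moreover have "compactin Y (f ` topspace X)"
    using assms(1,3) image_compactin unfolding arc_winding_space_def compact_space_def by blast
  then have "closedin Y (f ` topspace X)"
    using assms(2) compactin_imp_closedin metrizable_imp_Hausdorff_space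
    unfolding arc_winding_space_def by blast
  moreover have "f ` topspace X \<noteq> {}"
    using assms(1) unfolding arc_winding_space_def nondegenerate_space_def by blast
  ultimately show ?thesis
    using connected_space_clopen_in by blast
qed

text \<open>The composite \<open>X (m + n) \<rightarrow> X m\<close> of \<open>n\<close> bonding maps, that is, \<open>f m \<circ> \<dots> \<circ> f (m + n - 1)\<close>.\<close>

fun bonding_composite :: "(nat \<Rightarrow> 'a \<Rightarrow> 'a) \<Rightarrow> nat \<Rightarrow> nat \<Rightarrow> 'a \<Rightarrow> 'a" where
  "bonding_composite f m 0 x = x"
| "bonding_composite f m (Suc n) x = bonding_composite f m n (f (m + n) x)"

lemma bonding_composite_Suc_left:
  "f m (bonding_composite f (Suc m) n x) = bonding_composite f m (Suc n) x"
  by (induction n arbitrary: x) auto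

lemma continuous_map_bonding_composite:
  assumes "\<And>n. continuous_map (X (Suc n)) (X n) (f n)"
  shows "continuous_map (X (m + n)) (X m) (bonding_composite f m n)"
proof (induction n)
  case 0
  have "bonding_composite f m 0 = id" by auto
  then show ?case by simp
next
  case (Suc n)
  have "continuous_map (X (Suc (m + n))) (X m) (bonding_composite f m n \<circ> f (m + n))"
    using continuous_map_compose[OF assms Suc] .
  then show ?case by (simp add: o_def)
qed

lemma bonding_composite_coherent:
  assumes "\<And>n. x n = f n (x (Suc n))"
  shows "bonding_composite f m n (x (m + n)) = x m"
  by (induction n) (use assms[of "m + _", symmetric] in \<open>simp_all\<close>)

lemma topspace_inverse_limit:
  "topspace (inverse_limit X f) = {x. (\<forall>n. x n \<in> topspace (X n)) \<and> (\<forall>n. x n = f n (x (Suc n)))}"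
  unfolding inverse_limit_def by auto

text \<open>A coherent family of maps into the stages from \<open>N\<close> on determines a map into the inverse limit. Its \<open>m\<close>-th
coordinate is pushed down from stage \<open>m + N\<close> for every \<open>m\<close>, which avoids a case distinction
between the stages below and above \<open>N\<close>.\<close>

lemma inverse_limit_extend_from_stage:
  assumes cont: "\<And>n. continuous_map (X (Suc n)) (X n) (f n)"
    and \<delta>: "\<And>k. continuous_map T (X (N + k)) (\<delta> k)"
    and lift: "\<And>k u. u \<in> topspace T \<Longrightarrow> f (N + k) (\<delta> (Suc k) u) = \<delta> k u"
  defines "\<Phi> \<equiv> (\<lambda>u m. bonding_composite f m N (\<delta> m u))"
  shows "continuous_map T (inverse_limit X f) \<Phi>"
proof -
  have "continuous_map T (X m) (\<lambda>u. \<Phi> u m)" for m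
    using continuous_map_compose[OF \<delta>[of m], of "X m" "bonding_composite f m N"]
      continuous_map_bonding_composite[of X f m N, OF cont]
    unfolding \<Phi>_def by (simp add: o_def add.commute)
  then have "continuous_map T (product_topology X UNIV) \<Phi>"
    by (simp add: continuous_map_componentwise_UNIV)
  moreover have "\<Phi> u m = f m (\<Phi> u (Suc m))" if "u \<in> topspace T" for u m
  proof -
    have "f m (\<Phi> u (Suc m)) = bonding_composite f m N (f (m + N) (\<delta> (Suc m) u))"
      unfolding \<Phi>_def by (simp add: bonding_composite_Suc_left)
    then show ?thesis
      using lift[OF that, of m] by (simp add: \<Phi>_def add.commute)
  qed
  ultimately show ?thesis
    unfolding inverse_limit_def continuous_map_in_subtopology by blast
qed

text \<open>A basic open set of the product around \<open>c\<close> restricts only coordinates up to some \<open>N\<close>, and in a thread the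
\<open>N\<close>-th coordinate determines all earlier ones.\<close>

lemma inverse_limit_stage_separates:
  assumes A: "closedin (inverse_limit X f) A" and c: "c \<in> topspace (inverse_limit X f)" "c \<notin> A"
  obtains N where "\<And>y. \<lbrakk>y \<in> topspace (inverse_limit X f); y N = c N\<rbrakk> \<Longrightarrow> y \<notin> A"
proof -
  obtain V where V: "openin (product_topology X UNIV) V"
    and AV: "topspace (inverse_limit X f) - A = V \<inter> {x. \<forall>n. x n = f n (x (Suc n))}"
    using A unfolding closedin_def inverse_limit_def openin_subtopology by blast
  have "c \<in> V"
    using AV c by blast
  then obtain U where fin: "finite {i. U i \<noteq> topspace (X i)}"
    and cU: "c \<in> Pi\<^sub>E UNIV U" and UV: "Pi\<^sub>E UNIV U \<subseteq> V"
    using V unfolding openin_product_topology_alt by auto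
  obtain N where N: "\<And>i. U i \<noteq> topspace (X i) \<Longrightarrow> i \<le> N"
    using finite_nat_set_iff_bounded_le[THEN iffD1, OF fin] by blast
  have "y \<notin> A" if y: "y \<in> topspace (inverse_limit X f)" and yN: "y N = c N" for y
  proof -
    have "y i \<in> U i" for i
    proof (cases "i \<le> N")
      case True
      then obtain k where "N = i + k"
        using le_Suc_ex by blast
      have "z i = bonding_composite f i k (z N)" if "z \<in> topspace (inverse_limit X f)" for z
        unfolding \<open>N = i + k\<close>
        by (rule bonding_composite_coherent[symmetric])
           (use that in \<open>unfold topspace_inverse_limit, blast\<close>)
      then have "y i = c i"
        using y c(1) yN by metis
      then show ?thesis
        using cU by (auto simp: PiE_iff)
    next
      case False
      then have "U i = topspace (X i)"
        using N by blast
      then show ?thesis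
        using y unfolding topspace_inverse_limit by blast
    qed
    then have "y \<in> V"
      using UV by (auto simp: PiE_iff)
    then show ?thesis
      using AV y unfolding topspace_inverse_limit by blast
  qed
  then show ?thesis
    using that by blast
qed

text \<open>Starting from an arc in a stage that separates \<open>c\<close> from \<open>A\<close>, dependent choice lifts it stage by stage along the
coordinates of \<open>a\<close>.\<close>

lemma enough_arcs_inverse_limit:
  fixes X :: "nat \<Rightarrow> 'b topology"
  assumes X: "\<And>n. arc_winding_space (X n)"
    and cont: "\<And>n. continuous_map (X (Suc n)) (X n) (f n)"
    and opn: "\<And>n. open_map (X (Suc n)) (X n) (f n)"
  shows "enough_arcs (inverse_limit X f)"
proof -
  let ?L = "inverse_limit X f"
  have surj: "f n ` topspace (X (Suc n)) = topspace (X n)" for n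
    using open_map_arc_winding_spaces_surjective X cont opn by blast
  have H: "Hausdorff_space (X n)" for n
    using X metrizable_imp_Hausdorff_space unfolding arc_winding_space_def by blast
  have "metrizable_space (X n)" for n
    using X unfolding arc_winding_space_def by blast
  then have mt: "metrizable_space ?L"
    unfolding inverse_limit_def
    by (intro metrizable_space_subtopology) (auto simp: metrizable_space_product_topology)
  have HL: "Hausdorff_space ?L"
    using mt metrizable_imp_Hausdorff_space by blast
  have thread: "\<exists>x \<in> topspace ?L. x 0 = s" if "s \<in> topspace (X 0)" for s
  proof -
    have "\<exists>x. \<forall>n. (x n \<in> topspace (X n) \<and> (n = 0 \<longrightarrow> x n = s)) \<and> x n = f n (x (Suc n))"
    proof (rule dependent_nat_choice)
      fix x n assume "x \<in> topspace (X n) \<and> (n = 0 \<longrightarrow> x = s)"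
      then show "\<exists>y. (y \<in> topspace (X (Suc n)) \<and> (Suc n = 0 \<longrightarrow> y = s)) \<and> x = f n y"
        using surj[of n] by (auto simp: image_iff)
    qed (use that in auto)
    then show ?thesis
      unfolding topspace_inverse_limit by blast
  qed
  obtain s t where st: "s \<in> topspace (X 0)" "t \<in> topspace (X 0)" "s \<noteq> t"
    using X[of 0] unfolding arc_winding_space_def nondegenerate_space_def by blast
  have nd: "nondegenerate_space ?L"
    using thread[OF st(1)] thread[OF st(2)] st(3) unfolding nondegenerate_space_def by metis
  show ?thesis
    unfolding enough_arcs_def
  proof (intro conjI allI impI nd mt)
    fix A assume A: "closedin ?L A \<and> A \<noteq> {} \<and> A \<noteq> topspace ?L"
    then obtain a c where a: "a \<in> A" "a \<in> topspace ?L" and c: "c \<in> topspace ?L" "c \<notin> A"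
      using closedin_subset by blast
    obtain N where N: "\<And>y. \<lbrakk>y \<in> topspace ?L; y N = c N\<rbrakk> \<Longrightarrow> y \<notin> A"
      using inverse_limit_stage_separates[of X f A c] A c by blast
    have aX: "a n \<in> topspace (X n)" and af: "a n = f n (a (Suc n))"
      and cX: "c n \<in> topspace (X n)" for n
      using a c unfolding topspace_inverse_limit by blast+
    have "a N \<noteq> c N"
      using N a by blast
    then obtain C where "arc_in_with_endpoints (X N) C (a N) (c N)"
      using X[of N] aX cX unfolding arc_winding_space_def arcwise_connected_space_def by blast
    then obtain \<gamma> where \<gamma>: "continuous_map (top_of_set {0..1::real}) (X N) \<gamma>" "inj_on \<gamma> {0..1}"
      "\<gamma> 0 = a N" "\<gamma> 1 = c N"
      using arc_in_with_endpoints_imp_injective_path by metis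
    \<comment> \<open>The lift to stage \<open>N + k\<close> starts at the coordinate of \<open>a\<close>; the last conjunct pins the first lift
      to the chosen arc.\<close>
    define P where "P k \<delta> \<longleftrightarrow> continuous_map (top_of_set {0..1::real}) (X (N + k)) \<delta> \<and>
      inj_on \<delta> {0..1} \<and> \<delta> 0 = a (N + k) \<and> (k = 0 \<longrightarrow> \<delta> = \<gamma>)" for k \<delta>
    have "\<exists>\<delta>. \<forall>k. P k (\<delta> k) \<and> (\<forall>u \<in> {0..1}. f (N + k) (\<delta> (Suc k) u) = \<delta> k u)"
    proof (rule dependent_nat_choice)
      show "\<exists>\<delta>. P 0 \<delta>"
        using \<gamma> unfolding P_def by auto
    next
      fix \<delta> k assume \<delta>: "P k \<delta>"
      obtain q where q: "open_winding_map (X (N + Suc k)) q"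
        using X unfolding arc_winding_space_def by blast
      have "open_winding_map (X (N + k)) (f (N + k) \<circ> q)"
        using open_winding_map_compose[OF q, of "X (N + k)" "f (N + k)"] cont opn surj by simp
      moreover have "f (N + k) (a (N + Suc k)) = \<delta> 0"
        using \<delta> af[of "N + k"] unfolding P_def by simp
      ultimately obtain \<epsilon> where "continuous_map (top_of_set {0..1}) (X (N + Suc k)) \<epsilon>"
        "inj_on \<epsilon> {0..1}" "\<epsilon> 0 = a (N + Suc k)" "\<And>u. u \<in> {0..1} \<Longrightarrow> f (N + k) (\<epsilon> u) = \<delta> u"
        using arc_lift[OF H q, of "N + k" "f (N + k)" \<delta> "a (N + Suc k)"] \<delta> aX unfolding P_def
        by metis
      then show "\<exists>\<epsilon>. P (Suc k) \<epsilon> \<and> (\<forall>u \<in> {0..1}. f (N + k) (\<epsilon> u) = \<delta> u)"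
        unfolding P_def by (intro exI[of _ \<epsilon>]) auto
    qed
    then obtain \<delta> where \<delta>: "\<And>k. P k (\<delta> k)"
      and lift: "\<And>k u. u \<in> {0..1} \<Longrightarrow> f (N + k) (\<delta> (Suc k) u) = \<delta> k u"
      by blast
    define \<Phi> where "\<Phi> u m = bonding_composite f m N (\<delta> m u)" for u m
    have cont\<Phi>: "continuous_map (top_of_set {0..1}) ?L \<Phi>"
      unfolding \<Phi>_def[abs_def]
      by (rule inverse_limit_extend_from_stage[of X f, OF cont]) (use \<delta> lift in \<open>auto simp: P_def\<close>)
    have \<Phi>N: "\<Phi> u N = \<gamma> u" if "u \<in> {0..1}" for u
    proof -
      have "bonding_composite f N n (\<delta> n u) = \<gamma> u" for n
        by (induction n) (use \<delta>[of 0] lift that in \<open>auto simp: P_def\<close>)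
      then show ?thesis
        unfolding \<Phi>_def .
    qed
    have inj: "inj_on \<Phi> {0..1}"
      by (rule inj_onI) (metis \<Phi>N inj_onD[OF \<gamma>(2)])
    have "bonding_composite f m N (a (N + m)) = a m" for m
      by (subst add.commute) (rule bonding_composite_coherent, rule af)
    then have "\<Phi> 0 m = a m" for m
      using \<delta>[of m] unfolding \<Phi>_def P_def by simp
    then have "\<Phi> 0 = a" by blast
    moreover have "\<Phi> 1 \<in> topspace ?L"
      using continuous_map_image_subset_topspace[OF cont\<Phi>] by auto
    moreover have "\<Phi> 1 \<notin> A"
      using N[OF \<open>\<Phi> 1 \<in> topspace ?L\<close>] \<Phi>N[of 1] \<gamma>(4) by simp
    ultimately show "\<exists>C a b. arc_in_with_endpoints ?L C a b \<and> a \<in> A \<and> b \<in> topspace ?L - A"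
      using arc_in_with_endpoints_injective_path[OF HL cont\<Phi> inj] a(1) by blast
  qed
qed

theorem corollary9:
  shows "(\<forall>X :: 'a topology. nondegenerate_space X \<and> metrizable_space X \<and> (\<exists>\<phi>. minimal_flow X \<phi>)
            \<longrightarrow> enough_arcs X) \<and>
         (\<forall>X :: 'a topology. nondegenerate_space X \<and> metrizable_space X \<and> continuum X \<and>
            (\<forall>p\<in>topspace X. arcwise_connected_space (subtopology X (composant X p)))
            \<longrightarrow> enough_arcs X) \<and>
         (\<forall>(S :: 'a topology) (X :: nat \<Rightarrow> 'b topology) f. solenoid_of X f S \<longrightarrow> enough_arcs S) \<and>
         (\<forall>(S :: 'a topology) (X :: nat \<Rightarrow> 'b topology) f. knaster_continuum_of X f S \<longrightarrow> enough_arcs S)"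
proof (intro conjI allI impI)
  fix X :: "'a topology"
  assume "nondegenerate_space X \<and> metrizable_space X \<and> (\<exists>\<phi>. minimal_flow X \<phi>)"
  then show "enough_arcs X"
    using enough_arcs_minimal_flow by blast
next
  fix X :: "'a topology"
  assume "nondegenerate_space X \<and> metrizable_space X \<and> continuum X \<and>
    (\<forall>p\<in>topspace X. arcwise_connected_space (subtopology X (composant X p)))"
  then show "enough_arcs X"
    by (intro enough_arcs_arcwise_connected_composants) auto
next
  fix S :: "'a topology" and X :: "nat \<Rightarrow> 'b topology" and f
  assume S: "solenoid_of X f S"
  then have "enough_arcs (inverse_limit X f)"
    unfolding solenoid_of_def open_nonhomeomorphic_bonding_def
    by (intro enough_arcs_inverse_limit arc_winding_space_circle) auto
  moreover have "inverse_limit X f homeomorphic_space S"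
    using S homeomorphic_space_sym unfolding solenoid_of_def by metis
  ultimately show "enough_arcs S"
    using enough_arcs_homeomorphic_space by metis
next
  fix S :: "'a topology" and X :: "nat \<Rightarrow> 'b topology" and f
  assume S: "knaster_continuum_of X f S"
  then have "enough_arcs (inverse_limit X f)"
    unfolding knaster_continuum_of_def open_nonhomeomorphic_bonding_def
    by (intro enough_arcs_inverse_limit arc_winding_space_arc) auto
  moreover have "inverse_limit X f homeomorphic_space S"
    using S homeomorphic_space_sym unfolding knaster_continuum_of_def by metis
  ultimately show "enough_arcs S"
    using enough_arcs_homeomorphic_space by metis
qed

end
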